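(* Let $N$ be a positive integer. If $\left\lfloor \frac{N}{2} \right\rfloor \geq R(7,7)$, then $$f(2,N) \leq \left\lfloor \frac{N}{2} \right\rfloor + 4.$$
   Context: Let $k,N$ be positive integers and let $A,B$ be disjoint sets with $|A|=|B|=N$. For $S\subset A\cup B$ write $S_A=S\cap A$ and $S_B=S\cap B$. A family $\mathcal{S}$ of subsets of $A\cup B$ is called semiintersecting (with constants $k$ and $N$) if (i) $|S_A|=|S_B|=k$ for all $S\in\mathcal{S}$, and (ii) for all $S\neq T$ in $\mathcal{S}$, $S_A\cap T_A=\emptyset$ if and only if $S_B\cap T_B\neq\emptyset$. Define $f(k,N)$ to be the maximum of $|\mathcal{S}|$ over all semiintersecting families $\mathcal{S}$ with constants $k$ and $N$. For positive integers $a,b$, the Ramsey number $R(a,b)$ is the smallest integer such that every simple graph with $R(a,b)$ vertices contains either a clique of size $a$ or an independent set of size $b$. *)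

theory Defs
  imports "HOL-Library.Ramsey"
begin

definition semiintersecting :: "'a set \<Rightarrow> 'a set \<Rightarrow> nat \<Rightarrow> 'a set set \<Rightarrow> bool" where
  "semiintersecting A B k \<S> \<longleftrightarrow>
     \<S> \<subseteq> Pow (A \<union> B) \<and>
     (\<forall>S\<in>\<S>. card (S \<inter> A) = k \<and> card (S \<inter> B) = k) \<and>
     (\<forall>S\<in>\<S>. \<forall>T\<in>\<S>. S \<noteq> T \<longrightarrow>
        ((S \<inter> A) \<inter> (T \<inter> A) = {} \<longleftrightarrow> (S \<inter> B) \<inter> (T \<inter> B) \<noteq> {}))"

text \<open>The ground sets may be any two disjoint \<open>N\<close>-element sets; taking them among the
  sets of naturals loses nothing, see \<open>max_semiintersecting_eq\<close> below.\<close>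

definition max_semiintersecting :: "nat \<Rightarrow> nat \<Rightarrow> nat" where
  "max_semiintersecting k N =
     Max {card \<S> | (\<S> :: nat set set) A B.
            finite A \<and> finite B \<and> card A = N \<and> card B = N \<and> A \<inter> B = {} \<and>
            semiintersecting A B k \<S>}"

text \<open>Simple graphs are given by a finite vertex set and a set of two-element subsets of it.
  Vertices are naturals without loss of generality, see \<open>ramsey_number_works\<close> below.\<close>

definition ramsey_number :: "nat \<Rightarrow> nat \<Rightarrow> nat" where
  "ramsey_number a b =
     (LEAST r. \<forall>(V :: nat set) E. finite V \<and> card V = r \<and> E \<subseteq> [V]\<^bsup>2\<^esup> \<longrightarrow>
        (\<exists>R\<subseteq>V. card R = a \<and> clique R E \<or> card R = b \<and> indep R E))"

lemma semiintersecting_image: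
  assumes h: "inj_on h (A \<union> B)" and S: "semiintersecting A B k \<S>"
  shows "semiintersecting (h ` A) (h ` B) k ((`) h ` \<S>)" "card ((`) h ` \<S>) = card \<S>"
proof -
  have sub: "\<And>S. S \<in> \<S> \<Longrightarrow> S \<subseteq> A \<union> B" using S by (auto simp: semiintersecting_def)
  have intA: "h ` S \<inter> h ` A = h ` (S \<inter> A)" "h ` S \<inter> h ` B = h ` (S \<inter> B)" if "S \<in> \<S>" for S
    by (rule inj_on_image_Int[OF h sub[OF that], symmetric]; blast)+
  have injA: "inj_on h (S \<inter> A)" "inj_on h (S \<inter> B)" for S
    by (rule inj_on_subset[OF h]; blast)+
  have int2: "h ` (S \<inter> A) \<inter> h ` (T \<inter> A) = h ` ((S \<inter> A) \<inter> (T \<inter> A))"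
      "h ` (S \<inter> B) \<inter> h ` (T \<inter> B) = h ` ((S \<inter> B) \<inter> (T \<inter> B))" for S T
    by (rule inj_on_image_Int[OF h, symmetric]; blast)+
  have 1: "h ` S \<subseteq> h ` A \<union> h ` B" if "S \<in> \<S>" for S
    using sub[OF that] by auto
  have 2: "card (h ` S \<inter> h ` A) = k \<and> card (h ` S \<inter> h ` B) = k" if "S \<in> \<S>" for S
  proof -
    have "card (S \<inter> A) = k" "card (S \<inter> B) = k"
      using S that unfolding semiintersecting_def by blast+
    then show ?thesis unfolding intA[OF that] by (simp add: card_image[OF injA(1)] card_image[OF injA(2)])
  qed
  have 3: "((h ` S \<inter> h ` A) \<inter> (h ` T \<inter> h ` A) = {} \<longleftrightarrow>
      (h ` S \<inter> h ` B) \<inter> (h ` T \<inter> h ` B) \<noteq> {})"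
    if "S \<in> \<S>" "T \<in> \<S>" "h ` S \<noteq> h ` T" for S T
  proof -
    have "S \<noteq> T" using that(3) by auto
    then have "(S \<inter> A) \<inter> (T \<inter> A) = {} \<longleftrightarrow> (S \<inter> B) \<inter> (T \<inter> B) \<noteq> {}"
      using S that(1,2) unfolding semiintersecting_def by blast
    then show ?thesis unfolding intA[OF that(1)] intA[OF that(2)] int2 image_is_empty .
  qed
  show "semiintersecting (h ` A) (h ` B) k ((`) h ` \<S>)"
    unfolding semiintersecting_def ball_simps
    by (intro conjI ballI impI) (use 1 2 in blast, (simp add: 2)+, erule (2) 3)
  have "inj_on ((`) h) \<S>"
    using inj_on_image_eq_iff[OF h sub sub] by (intro inj_onI) blast
  then show "card ((`) h ` \<S>) = card \<S>" by (rule card_image)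
qed

lemma ground_bij:
  assumes "finite A" "finite B" "card A = card A'" "card B = card B'" "A \<inter> B = {}"
    "finite A'" "finite B'" "A' \<inter> B' = {}"
  obtains h where "inj_on h (A \<union> B)" "h ` A = A'" "h ` B = B'"
proof -
  obtain f g where f: "bij_betw f A A'" and g: "bij_betw g B B'"
    using assms finite_same_card_bij by metis
  define h where "h x = (if x \<in> A then f x else g x)" for x
  have hA: "bij_betw h A A'" using f by (rule bij_betw_cong[THEN iffD1, rotated]) (simp add: h_def)
  have hB: "bij_betw h B B'" using g
    by (rule bij_betw_cong[THEN iffD1, rotated]) (use assms(5) in \<open>auto simp: h_def\<close>)
  have "bij_betw h (A \<union> B) (A' \<union> B')" using bij_betw_combine[OF hA hB assms(8)] .
  with hA hB show thesis using that by (auto simp: bij_betw_def)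
qed

lemma max_semiintersecting_eq:
  fixes A B :: "'a set"
  assumes "finite A" "finite B" "card A = N" "card B = N" "A \<inter> B = {}"
  shows "max_semiintersecting k N = Max {card \<S> | \<S>. semiintersecting A B k \<S>}"
    and "finite {card \<S> | \<S>. semiintersecting A B k \<S>}"
    and "{card \<S> | \<S>. semiintersecting A B k \<S>} \<noteq> {}"
proof -
  let ?L = "{card \<S> | (\<S> :: nat set set) A B.
            finite A \<and> finite B \<and> card A = N \<and> card B = N \<and> A \<inter> B = {} \<and>
            semiintersecting A B k \<S>}"
  have "?L = {card \<S> | \<S>. semiintersecting A B k \<S>}"
  proof (intro equalityI subsetI)
    fix n assume "n \<in> ?L"
    then obtain \<S> :: "nat set set" and A' B' where *: "finite A'" "finite B'" "card A' = N"
      "card B' = N" "A' \<inter> B' = {}" "semiintersecting A' B' k \<S>" "n = card \<S>" by blast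
    obtain h where h: "inj_on h (A' \<union> B')" "h ` A' = A" "h ` B' = B"
      by (rule ground_bij[of A' B' A B]) (use * assms in auto)
    show "n \<in> {card \<S> | \<S>. semiintersecting A B k \<S>}"
      using semiintersecting_image[OF h(1) *(6)] *(7) unfolding h(2,3)
      by (intro CollectI exI[of _ "(`) h ` \<S>"]) simp
  next
    fix n assume "n \<in> {card \<S> | \<S>. semiintersecting A B k \<S>}"
    then obtain \<S> where *: "semiintersecting A B k \<S>" "n = card \<S>" by blast
    obtain h where h: "inj_on h (A \<union> B)" "h ` A = {0..<N}" "h ` B = {N..<2*N}"
      by (rule ground_bij[of A B "{0..<N}" "{N..<2*N}"]) (use assms in auto)
    have "card ((`) h ` \<S>) \<in> ?L"
      using semiintersecting_image(1)[OF h(1) *(1)] unfolding h(2,3)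
      by (intro CollectI exI[of _ "(`) h ` \<S>"] exI[of _ "{0..<N}"] exI[of _ "{N..<2*N}"]) auto
    then show "n \<in> ?L" using semiintersecting_image(2)[OF h(1) *(1)] *(2) by simp
  qed
  then show "max_semiintersecting k N = Max {card \<S> | \<S>. semiintersecting A B k \<S>}"
    unfolding max_semiintersecting_def by simp
  have "{card \<S> | \<S>. semiintersecting A B k \<S>} \<subseteq> card ` Pow (Pow (A \<union> B))"
    by (auto simp: semiintersecting_def)
  then show "finite {card \<S> | \<S>. semiintersecting A B k \<S>}"
    by (rule finite_subset) (use assms in auto)
  have "semiintersecting A B k {}" by (simp add: semiintersecting_def)
  then show "{card \<S> | \<S>. semiintersecting A B k \<S>} \<noteq> {}" by blast
qed

lemma ramsey_number_works:
  fixes V :: "'a set"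
  assumes V: "finite V" "card V = ramsey_number a b" and E: "E \<subseteq> [V]\<^bsup>2\<^esup>"
  shows "\<exists>R\<subseteq>V. card R = a \<and> clique R E \<or> card R = b \<and> indep R E"
proof -
  let ?P = "\<lambda>r. \<forall>(V :: nat set) E. finite V \<and> card V = r \<and> E \<subseteq> [V]\<^bsup>2\<^esup> \<longrightarrow>
        (\<exists>R\<subseteq>V. card R = a \<and> clique R E \<or> card R = b \<and> indep R E)"
  obtain r where r: "\<forall>(V :: nat set) E. finite V \<and> r \<le> card V \<longrightarrow>
      (\<exists>R\<subseteq>V. card R = a \<and> clique R E \<or> card R = b \<and> indep R E)"
    using ramsey2[of a b] by blast
  have "?P r" using r by simp
  then have "\<exists>r. ?P r" by (rule exI)
  then have P: "?P (ramsey_number a b)" unfolding ramsey_number_def by (rule LeastI_ex)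
  obtain h where h: "bij_betw h V {0..<card V}"
    using V(1) ex_bij_betw_finite_nat by blast
  define E' where "E' = (`) h ` E"
  have inj: "inj_on h V" and im: "h ` V = {0..<card V}" using h by (auto simp: bij_betw_def)
  have "E' \<subseteq> [h ` V]\<^bsup>2\<^esup>"
  proof
    fix e assume "e \<in> E'"
    then obtain e' where "e = h ` e'" "e' \<in> [V]\<^bsup>2\<^esup>" using E by (auto simp: E'_def)
    then show "e \<in> [h ` V]\<^bsup>2\<^esup>"
      using inj by (auto simp: nsets_def card_image inj_on_subset)
  qed
  moreover have "finite (h ` V)" "card (h ` V) = ramsey_number a b" using V im by auto
  ultimately obtain R' where R': "R' \<subseteq> h ` V"
      "card R' = a \<and> clique R' E' \<or> card R' = b \<and> indep R' E'"
    using P by blast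
  obtain R where R: "R \<subseteq> V" "R' = h ` R" using R'(1) by (meson subset_imageE)
  have c: "card R' = card R" using R inj by (simp add: card_image inj_on_subset)
  have e: "{h v, h w} \<in> E' \<longleftrightarrow> {v, w} \<in> E" if "v \<in> R" "w \<in> R" for v w
  proof
    assume "{h v, h w} \<in> E'"
    then obtain e where e: "e \<in> E" "h ` {v, w} = h ` e" by (auto simp: E'_def)
    have "e \<subseteq> V" using e(1) E by (auto simp: nsets_def)
    then have "{v, w} = e" using inj_on_image_eq_iff[OF inj, of "{v,w}" e] e(2) that R(1) by auto
    then show "{v, w} \<in> E" using e(1) by simp
  next
    assume "{v, w} \<in> E"
    then have "h ` {v, w} \<in> E'" unfolding E'_def by (rule imageI)
    then show "{h v, h w} \<in> E'" by simp
  qed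
  have ne: "h v \<noteq> h w" if "v \<in> R" "w \<in> R" "v \<noteq> w" for v w
    using that inj R(1) by (auto dest: inj_onD)
  have "clique R' E' \<Longrightarrow> clique R E" "indep R' E' \<Longrightarrow> indep R E"
    using e ne unfolding clique_def indep_def R(2) by auto
  then show ?thesis using R(1) R'(2) c by auto
qed

end

theory Submission
  imports Defs
begin

text \<open>
  Call two members of a semiintersecting family \<open>A\<close>-meeting if their traces on \<open>A\<close> meet;
  two distinct members that do not are \<open>B\<close>-meeting. If \<open>\<S>\<close> had more than
  \<open>N div 2 + 4\<close> members, Ramsey's theorem would give seven of them that are pairwise
  \<open>A\<close>-meeting (or pairwise \<open>B\<close>-meeting, which is the same situation with the two ground sets
  exchanged). Extend these seven to an inclusion-maximal pairwise \<open>A\<close>-meeting subfamily \<open>K\<close>. The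
  traces of \<open>K\<close> on \<open>B\<close> are a matching, so \<open>2 * card K \<le> N\<close>
  (\<open>card_intersecting_on_le\<close>), and it remains to see that at most four members lie outside
  \<open>K\<close> (\<open>card_outside_maximal_le_4\<close>).

  The engine is \<open>card_missing_le\<close>: a pairwise \<open>A\<close>-meeting subfamily all of whose members miss
  a fixed member \<open>T\<close> on \<open>A\<close> has at most two members, because their traces on \<open>B\<close> are disjoint and
  each contains one of the two points of \<open>T \<inter> B\<close>. It is used in both directions. An outside
  member misses one or two members of \<open>K\<close>, at least one because \<open>K\<close> is maximal; and a pairwise
  \<open>A\<close>-meeting set of outside members that all miss the same member of \<open>K\<close> has size at most two.
  So it suffices to find two members of \<open>K\<close> such that each outside member misses one of them,
  with the outside members that miss either one pairwise \<open>A\<close>-meeting.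

  The traces of \<open>K\<close> on \<open>A\<close> are pairwise intersecting edges, hence the three sides of a triangle
  or a star. In a triangle, some side carries at least three members of \<open>K\<close>, so every outside
  member meets this side, and the other two sides do the job. In a star with centre \<open>v\<close>, no outside
  trace contains \<open>v\<close>, so any two outside members are \<open>A\<close>-meeting, since otherwise each
  member of \<open>K\<close> would be missed by one of the two, and \<open>card K \<le> 4\<close>. Hence the outside
  traces again form a triangle or a star; a triangle would give \<open>card K \<le> 6\<close> in the same way, and
  for a star the required two members of \<open>K\<close> are found directly.
\<close>

section \<open>Intersecting traces\<close>

text \<open>The case \<open>S = T\<close> is included, so members with an empty trace are ruled out; in
  \<open>card_missing_le\<close> below this is what keeps \<open>T\<close> itself out of \<open>G\<close>.\<close>

definition intersecting_on :: "'a set \<Rightarrow> 'a set set \<Rightarrow> bool" where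
  "intersecting_on A G \<longleftrightarrow> (\<forall>S\<in>G. \<forall>T\<in>G. S \<inter> T \<inter> A \<noteq> {})"

lemma intersecting_on_subset: "intersecting_on A G \<Longrightarrow> H \<subseteq> G \<Longrightarrow> intersecting_on A H"
  by (auto simp: intersecting_on_def)

lemma intersecting_on_insert:
  assumes "intersecting_on A G" "T \<inter> A \<noteq> {}" "\<And>S. S \<in> G \<Longrightarrow> S \<inter> T \<inter> A \<noteq> {}"
  shows "intersecting_on A (insert T G)"
  using assms unfolding intersecting_on_def by (auto simp: Int_commute)

lemma traceE:
  assumes "e \<in> (\<lambda>S. S \<inter> A) ` G"
  obtains S where "S \<in> G" "S \<inter> A = e"
  using assms by (rule imageE) (use that in simp)

lemma disjoint_trace_pair_iff:
  assumes "S \<inter> A = {x, y}"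
  shows "S \<inter> T \<inter> A = {} \<longleftrightarrow> x \<notin> T \<and> y \<notin> T"
proof -
  have "S \<inter> T \<inter> A = (S \<inter> A) \<inter> T" by auto
  then show ?thesis unfolding assms by auto
qed

section \<open>Semiintersecting families\<close>

lemma semiintersecting_meet_iff:
  assumes "semiintersecting A B k \<S>" "S \<in> \<S>" "T \<in> \<S>" "S \<noteq> T"
  shows "S \<inter> T \<inter> A = {} \<longleftrightarrow> S \<inter> T \<inter> B \<noteq> {}"
proof -
  have "S \<inter> A \<inter> (T \<inter> A) = S \<inter> T \<inter> A" "S \<inter> B \<inter> (T \<inter> B) = S \<inter> T \<inter> B" by auto
  then show ?thesis using assms unfolding semiintersecting_def by metis
qed

lemma semiintersecting_commute:
  fixes A B :: "'a set"
  shows "semiintersecting A B k \<S> \<longleftrightarrow> semiintersecting B A k \<S>"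
proof -
  have "semiintersecting B A k \<S>" if "semiintersecting A B k \<S>" for A B :: "'a set"
    using that unfolding semiintersecting_def Un_commute[of B A] by metis
  then show ?thesis by blast
qed

text \<open>The traces of \<open>G\<close> on \<open>B\<close> are pairwise disjoint, and each of them contains one of the
  \<open>k\<close> points of \<open>T \<inter> B\<close>.\<close>

lemma card_missing_le:
  assumes \<S>: "semiintersecting A B k \<S>" and "k > 0"
    and G: "G \<subseteq> \<S>" "intersecting_on A G"
    and T: "T \<in> \<S>" "\<And>S. S \<in> G \<Longrightarrow> S \<inter> T \<inter> A = {}"
  shows "card G \<le> k"
proof -
  have cT: "card (T \<inter> B) = k" using \<S> T(1) by (auto simp: semiintersecting_def)
  have "\<exists>x. x \<in> S \<inter> T \<inter> B" if "S \<in> G" for S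
  proof -
    have "S \<inter> S \<inter> A \<noteq> {}" using that G(2) unfolding intersecting_on_def by blast
    then have "S \<noteq> T" using T(2)[OF that] by auto
    then show ?thesis using semiintersecting_meet_iff[OF \<S>] G(1) T that by blast
  qed
  then obtain f where f: "\<And>S. S \<in> G \<Longrightarrow> f S \<in> S \<inter> T \<inter> B" by metis
  have "inj_on f G"
  proof (rule inj_onI, rule ccontr)
    fix S S' assume *: "S \<in> G" "S' \<in> G" "f S = f S'" "S \<noteq> S'"
    then have "S \<inter> S' \<inter> A \<noteq> {}" using G(2) unfolding intersecting_on_def by blast
    then have "S \<inter> S' \<inter> B = {}" using semiintersecting_meet_iff[OF \<S>, of S S'] * G(1) by blast
    then show False using f[OF *(1)] f[OF *(2)] *(3) by auto
  qed
  moreover have "f ` G \<subseteq> T \<inter> B" using f by auto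
  moreover have "finite (T \<inter> B)" using cT \<open>k > 0\<close> card_ge_0_finite by metis
  ultimately show ?thesis using card_inj_on_le cT by metis
qed

text \<open>The traces on \<open>B\<close> are pairwise disjoint \<open>k\<close>-sets, so they pack into \<open>B\<close>.\<close>

lemma card_intersecting_on_le:
  assumes \<S>: "semiintersecting A B k \<S>" and "finite B"
    and G: "G \<subseteq> \<S>" "finite G" "intersecting_on A G"
  shows "k * card G \<le> card B"
proof -
  have "card (\<Union>S\<in>G. S \<inter> B) = (\<Sum>S\<in>G. card (S \<inter> B))"
  proof (rule card_UN_disjoint)
    show "\<forall>S\<in>G. \<forall>T\<in>G. S \<noteq> T \<longrightarrow> S \<inter> B \<inter> (T \<inter> B) = {}"
    proof (intro ballI impI)
      fix S T assume *: "S \<in> G" "T \<in> G" "S \<noteq> T"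
      then have "S \<inter> T \<inter> A \<noteq> {}" using G(3) unfolding intersecting_on_def by blast
      then have "S \<inter> T \<inter> B = {}" using semiintersecting_meet_iff[OF \<S>, of S T] * G(1) by blast
      then show "S \<inter> B \<inter> (T \<inter> B) = {}" by blast
    qed
  qed (use G \<open>finite B\<close> in auto)
  also have "\<dots> = (\<Sum>S\<in>G. k)"
    using \<S> G(1) by (intro sum.cong) (auto simp: semiintersecting_def)
  finally have "k * card G = card (\<Union>S\<in>G. S \<inter> B)" by simp
  also have "\<dots> \<le> card B" by (rule card_mono) (use \<open>finite B\<close> in auto)
  finally show ?thesis .
qed

section \<open>Pairwise intersecting edges\<close>

lemma card_2_eqI: "card e = 2 \<Longrightarrow> x \<in> e \<Longrightarrow> y \<in> e \<Longrightarrow> x \<noteq> y \<Longrightarrow> e = {x, y}"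
  by (auto simp: card_2_iff)

text \<open>If some edges avoid either end of an edge \<open>{x, y}\<close>, one of each kind closes a triangle with
  it; an edge that meets all three sides is a side.\<close>

lemma star_or_triangle:
  assumes edges: "\<forall>e\<in>F. card e = 2" and meet: "\<forall>e\<in>F. \<forall>f\<in>F. e \<inter> f \<noteq> {}"
  obtains (star) v where "\<And>e. e \<in> F \<Longrightarrow> v \<in> e"
  | (triangle) x y z where "x \<noteq> y" "y \<noteq> z" "x \<noteq> z" "F = {{x, y}, {y, z}, {x, z}}"
proof -
  note F = bspec[OF edges] bspec[OF bspec[OF meet]]
  show thesis
  proof (cases "\<exists>v. \<forall>e\<in>F. v \<in> e")
    case True
    then show ?thesis using star by blast
  next
    case False
    then obtain e where e: "e \<in> F" by blast
    then obtain x y where xy: "e = {x, y}" "x \<noteq> y" using F(1) card_2_iff by metis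
    obtain f where f: "f \<in> F" "x \<notin> f" using False by blast
    then have "y \<in> f" using F(2)[OF e f(1)] xy by auto
    then obtain z where z: "f = {y, z}" "y \<noteq> z" using F(1)[OF f(1)] by (auto simp: card_2_iff)
    obtain g where g: "g \<in> F" "y \<notin> g" using False by blast
    have "x \<in> g" "z \<in> g" using F(2)[OF e g(1)] F(2)[OF f(1) g(1)] xy z g(2) by auto
    moreover have "x \<noteq> z" using f z by auto
    ultimately have g': "g = {x, z}" using F(1)[OF g(1)] card_2_eqI by metis
    have "h \<in> {{x, y}, {y, z}, {x, z}}" if h: "h \<in> F" for h
    proof -
      have "h \<inter> {x, y} \<noteq> {}" "h \<inter> {y, z} \<noteq> {}" "h \<inter> {x, z} \<noteq> {}"
        using F(2)[OF h] e f(1) g(1) xy z g' by auto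
      then have "(x \<in> h \<and> y \<in> h) \<or> (y \<in> h \<and> z \<in> h) \<or> (x \<in> h \<and> z \<in> h)" by auto
      then show ?thesis
        using card_2_eqI[OF F(1)[OF h]] xy(2) z(2) \<open>x \<noteq> z\<close> by blast
    qed
    then have "F = {{x, y}, {y, z}, {x, z}}" using e f(1) g(1) xy z g' by auto
    then show ?thesis using triangle xy(2) z(2) \<open>x \<noteq> z\<close> by blast
  qed
qed

section \<open>Members outside a maximal intersecting subfamily\<close>

locale maximal_intersecting =
  fixes A B :: "'a set" and \<S> K :: "'a set set"
  assumes semi: "semiintersecting A B 2 \<S>"
    and K_sub: "K \<subseteq> \<S>"
    and K_int: "intersecting_on A K"
    and K_card: "card K \<ge> 7"
    and K_maximal: "\<And>T. T \<in> \<S> - K \<Longrightarrow> \<not> intersecting_on A (insert T K)"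
begin

lemma card_trace: "T \<in> \<S> \<Longrightarrow> card (T \<inter> A) = 2"
  using semi by (auto simp: semiintersecting_def)

lemma finite_K: "finite K"
  using K_card card.infinite by fastforce

definition missed :: "'a set \<Rightarrow> 'a set set" where
  "missed T = {k \<in> K. k \<inter> T \<inter> A = {}}"

lemma finite_missed: "finite (missed T)"
  using finite_K by (simp add: missed_def)

lemma card_missed_le: "T \<in> \<S> \<Longrightarrow> card (missed T) \<le> 2"
  using K_sub K_int
  by (intro card_missing_le[OF semi, where T = T])
     (auto simp: missed_def intro: intersecting_on_subset)

lemma missed_nonempty:
  assumes "T \<in> \<S> - K"
  obtains k where "k \<in> K" "k \<inter> T \<inter> A = {}"
proof -
  have "T \<inter> A \<noteq> {}" using card_trace[of T] assms by force
  then show ?thesis using that K_maximal[OF assms] intersecting_on_insert[OF K_int] by blast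
qed

lemma card_outside_missing_le:
  assumes "k \<in> K" "G \<subseteq> \<S> - K" "intersecting_on A G" "\<And>T. T \<in> G \<Longrightarrow> k \<inter> T \<inter> A = {}"
  shows "card G \<le> 2"
  using assms K_sub by (intro card_missing_le[OF semi, where T = k]) (auto simp: Int_commute)

text \<open>The two outside groups, those missing \<open>k1\<close> and those missing \<open>k2\<close>, have at most two
  members each. The case \<open>k1 = k2\<close> is allowed.\<close>

lemma card_outside_le_4_of_two_missed:
  assumes k: "k1 \<in> K" "k2 \<in> K"
    and cover: "\<And>T. T \<in> \<S> - K \<Longrightarrow> k1 \<inter> T \<inter> A = {} \<or> k2 \<inter> T \<inter> A = {}"
    and int: "intersecting_on A {T \<in> \<S> - K. k1 \<inter> T \<inter> A = {}}"
      "intersecting_on A {T \<in> \<S> - K. k2 \<inter> T \<inter> A = {}}"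
  shows "card (\<S> - K) \<le> 4"
proof -
  let ?G = "\<lambda>k. {T \<in> \<S> - K. k \<inter> T \<inter> A = {}}"
  have "\<S> - K = ?G k1 \<union> ?G k2" using cover by blast
  then have "card (\<S> - K) = card (?G k1 \<union> ?G k2)" by (rule arg_cong)
  also have "\<dots> \<le> card (?G k1) + card (?G k2)" by (rule card_Un_le)
  finally have "card (\<S> - K) \<le> card (?G k1) + card (?G k2)" .
  moreover have "card (?G k1) \<le> 2"
    by (rule card_outside_missing_le[OF k(1) _ int(1)]) blast+
  moreover have "card (?G k2) \<le> 2"
    by (rule card_outside_missing_le[OF k(2) _ int(2)]) blast+
  ultimately show ?thesis by linarith
qed

text \<open>A side of the triangle that carries three members of \<open>K\<close> meets every outside trace, since an
  outside member misses at most two members of \<open>K\<close>. But an outside trace cannot contain two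
  corners, or it would meet all of \<open>K\<close>. So it contains exactly one end of the heavy side and
  misses the side of the triangle through the other end.\<close>

lemma card_outside_le_4_heavy_side:
  assumes distinct: "x \<noteq> y" "y \<noteq> z" "x \<noteq> z"
    and K: "(\<lambda>k. k \<inter> A) ` K = {{x, y}, {y, z}, {x, z}}"
    and heavy: "card {k \<in> K. k \<inter> A = {y, z}} \<ge> 3"
  shows "card (\<S> - K) \<le> 4"
proof -
  have "{x, z} \<in> (\<lambda>k. k \<inter> A) ` K" "{x, y} \<in> (\<lambda>k. k \<inter> A) ` K" unfolding K by simp_all
  then obtain k1 k2 where k: "k1 \<in> K" "k1 \<inter> A = {x, z}" "k2 \<in> K" "k2 \<inter> A = {x, y}"
    by (elim traceE)
  have corner: "y \<in> T \<and> x \<notin> T \<and> z \<notin> T \<or> z \<in> T \<and> x \<notin> T \<and> y \<notin> T" if T: "T \<in> \<S> - K" for T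
  proof -
    obtain k where m: "k \<in> K" "k \<inter> T \<inter> A = {}" using missed_nonempty[OF T] .
    have "k \<inter> A \<in> (\<lambda>k. k \<inter> A) ` K" using m(1) by simp
    then have "k \<inter> A \<in> {{x, y}, {y, z}, {x, z}}" unfolding K .
    moreover have "(k \<inter> A) \<inter> T = {}" using m(2) by auto
    ultimately have two: "\<not> (x \<in> T \<and> y \<in> T)" "\<not> (y \<in> T \<and> z \<in> T)" "\<not> (x \<in> T \<and> z \<in> T)"
      by auto
    have "\<not> {k \<in> K. k \<inter> A = {y, z}} \<subseteq> missed T"
      using card_mono[OF finite_missed, of "{k \<in> K. k \<inter> A = {y, z}}" T] heavy
        card_missed_le[of T] T by auto
    then obtain k3 where k3: "k3 \<inter> A = {y, z}" "k3 \<inter> T \<inter> A \<noteq> {}"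
      unfolding missed_def by blast
    then have "y \<in> T \<or> z \<in> T" using disjoint_trace_pair_iff[OF k3(1)] by blast
    then show ?thesis using two by blast
  qed
  have xyz: "x \<in> A" "y \<in> A" "z \<in> A" using k by auto
  note miss1 = disjoint_trace_pair_iff[OF k(2)] and miss2 = disjoint_trace_pair_iff[OF k(4)]
  show ?thesis
  proof (rule card_outside_le_4_of_two_missed[OF k(1) k(3)])
    show "k1 \<inter> T \<inter> A = {} \<or> k2 \<inter> T \<inter> A = {}" if "T \<in> \<S> - K" for T
      using corner[OF that] miss1 miss2 by blast
    have "y \<in> T" if "T \<in> \<S> - K" "k1 \<inter> T \<inter> A = {}" for T
      using corner[OF that(1)] that(2) miss1 by blast
    then show "intersecting_on A {T \<in> \<S> - K. k1 \<inter> T \<inter> A = {}}"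
      unfolding intersecting_on_def using xyz by blast
    have "z \<in> T" if "T \<in> \<S> - K" "k2 \<inter> T \<inter> A = {}" for T
      using corner[OF that(1)] that(2) miss2 by blast
    then show "intersecting_on A {T \<in> \<S> - K. k2 \<inter> T \<inter> A = {}}"
      unfolding intersecting_on_def using xyz by blast
  qed
qed

lemma card_outside_le_4_triangle:
  assumes d: "x \<noteq> y" "y \<noteq> z" "x \<noteq> z"
    and K: "(\<lambda>k. k \<inter> A) ` K = {{x, y}, {y, z}, {x, z}}"
  shows "card (\<S> - K) \<le> 4"
proof -
  let ?c = "\<lambda>e. {k \<in> K. k \<inter> A = e}"
  have "k \<in> ?c {x, y} \<union> ?c {y, z} \<union> ?c {x, z}" if "k \<in> K" for k
  proof -
    have "k \<inter> A \<in> (\<lambda>k. k \<inter> A) ` K" using that by simp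
    then show ?thesis unfolding K using that by simp
  qed
  then have "card K \<le> card (?c {x, y} \<union> ?c {y, z} \<union> ?c {x, z})"
    using finite_K by (intro card_mono subsetI) simp_all
  also have "\<dots> \<le> card (?c {x, y}) + card (?c {y, z}) + card (?c {x, z})"
    by (meson add_le_mono1 card_Un_le order_trans)
  finally consider "card (?c {x, y}) \<ge> 3" | "card (?c {y, z}) \<ge> 3" | "card (?c {x, z}) \<ge> 3"
    using K_card by linarith
  then show ?thesis
  proof cases
    case 1
    have "(\<lambda>k. k \<inter> A) ` K = {{z, x}, {x, y}, {z, y}}" unfolding K by auto
    then show ?thesis
      using 1 d by (intro card_outside_le_4_heavy_side[of z x y]) simp_all
  next
    case 2
    show ?thesis by (rule card_outside_le_4_heavy_side[OF d K 2])
  next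
    case 3
    have "(\<lambda>k. k \<inter> A) ` K = {{y, x}, {x, z}, {y, z}}" unfolding K by auto
    then show ?thesis
      using 3 d by (intro card_outside_le_4_heavy_side[of y x z]) simp_all
  qed
qed

text \<open>Missing a member of a star is decided by its leaf alone, as no outside trace contains the
  centre. If two or three outside traces have no common point, each leaf avoids one of them, so the
  corresponding outside members together miss all of \<open>K\<close>. As each of them misses at most two members,
  this contradicts \<open>card K \<ge> 7\<close>. So the outside traces form a star as well; its centre is
  called \<open>x\<close>.\<close>

lemma card_outside_le_4_star:
  assumes v: "\<And>k. k \<in> K \<Longrightarrow> v \<in> k \<inter> A"
  shows "card (\<S> - K) \<le> 4"
proof -
  have leaf: "\<exists>u. k \<inter> A = {v, u}" if "k \<in> K" for k
  proof -
    have "card (k \<inter> A) = 2" using card_trace that K_sub by blast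
    then obtain a b where "k \<inter> A = {a, b}" by (auto simp: card_2_iff)
    then show ?thesis using v[OF that] by (auto simp: insert_commute)
  qed
  have v_out: "v \<notin> T" if "T \<in> \<S> - K" for T
    using missed_nonempty[OF that] v by blast
  have O_int: "intersecting_on A (\<S> - K)"
    unfolding intersecting_on_def
  proof (intro ballI notI)
    fix S T assume ST: "S \<in> \<S> - K" "T \<in> \<S> - K" "S \<inter> T \<inter> A = {}"
    \<comment> \<open>The leaf of \<open>k\<close> cannot lie in both of the disjoint traces.\<close>
    have "k \<in> missed S \<union> missed T" if k: "k \<in> K" for k
    proof -
      obtain u where u: "k \<inter> A = {v, u}" using leaf[OF k] by blast
      then have "u \<notin> S \<or> u \<notin> T" using ST(3) by blast
      then show ?thesis
        using k v_out[OF ST(1)] v_out[OF ST(2)]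
        by (auto simp: missed_def disjoint_trace_pair_iff[OF u])
    qed
    then have "card K \<le> card (missed S \<union> missed T)"
      using finite_missed by (intro card_mono) blast+
    also have "\<dots> \<le> card (missed S) + card (missed T)" by (rule card_Un_le)
    also have "\<dots> \<le> 2 + 2" using ST card_missed_le by (intro add_mono) auto
    finally show False using K_card by simp
  qed
  define F where "F = (\<lambda>T. T \<inter> A) ` (\<S> - K)"
  have F1: "\<forall>e\<in>F. card e = 2" using card_trace by (auto simp: F_def)
  have F2: "\<forall>e\<in>F. \<forall>f\<in>F. e \<inter> f \<noteq> {}"
    using O_int unfolding F_def intersecting_on_def by blast
  show ?thesis
  proof (cases rule: star_or_triangle[OF F1 F2, case_names star triangle])
    case (triangle x y z)
    have "{x, y} \<in> F" "{y, z} \<in> F" "{x, z} \<in> F" using triangle(4) by simp_all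
    then obtain T1 T2 T3 where T: "T1 \<in> \<S> - K" "T1 \<inter> A = {x, y}" "T2 \<in> \<S> - K" "T2 \<inter> A = {y, z}"
      "T3 \<in> \<S> - K" "T3 \<inter> A = {x, z}"
      unfolding F_def by (elim traceE)
    \<comment> \<open>The leaf of \<open>k\<close> lies on at most two sides of the triangle.\<close>
    have "k \<in> missed T1 \<union> missed T2 \<union> missed T3" if k: "k \<in> K" for k
    proof -
      obtain u where u: "k \<inter> A = {v, u}" using leaf[OF k] by blast
      have "u \<notin> {x, y} \<or> u \<notin> {y, z} \<or> u \<notin> {x, z}" using triangle by blast
      then have "u \<notin> T1 \<or> u \<notin> T2 \<or> u \<notin> T3" using T(2,4,6) u by blast
      then show ?thesis
        using k v_out[OF T(1)] v_out[OF T(3)] v_out[OF T(5)]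
        by (auto simp: missed_def disjoint_trace_pair_iff[OF u])
    qed
    then have "card K \<le> card (missed T1 \<union> missed T2 \<union> missed T3)"
      using finite_missed by (intro card_mono) blast+
    also have "\<dots> \<le> card (missed T1) + card (missed T2) + card (missed T3)"
      by (meson add_le_mono1 card_Un_le order_trans)
    also have "\<dots> \<le> 2 + 2 + 2" using T card_missed_le by (intro add_mono) auto
    finally show ?thesis using K_card by simp
  next
    case (star x)
    have x: "x \<in> T \<inter> A" if "T \<in> \<S> - K" for T using star that unfolding F_def by blast
    show ?thesis
    proof (cases "\<S> - K = {}")
      case False
      then obtain T0 where T0: "T0 \<in> \<S> - K" by blast
      obtain k1 where k1: "k1 \<in> K" "k1 \<inter> T0 \<inter> A = {}" using missed_nonempty[OF T0] .
      have int: "intersecting_on A {T \<in> \<S> - K. k \<inter> T \<inter> A = {}}" for k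
        by (rule intersecting_on_subset[OF O_int]) auto
      show ?thesis
      proof (cases "\<exists>T1 \<in> \<S> - K. k1 \<inter> T1 \<inter> A \<noteq> {}")
        case False
        then show ?thesis
          by (intro card_outside_le_4_of_two_missed[OF k1(1) k1(1)] int) blast
      next
        case True
        then obtain T1 where T1: "T1 \<in> \<S> - K" "k1 \<inter> T1 \<inter> A \<noteq> {}" by blast
        \<comment> \<open>The trace of \<open>T1\<close> consists of \<open>x\<close> and the leaf \<open>u1\<close> of \<open>k1\<close>, so a member \<open>k2\<close> of
          \<open>K\<close> missed by \<open>T1\<close> has a leaf other than \<open>x\<close> and \<open>u1\<close>. An outside trace has room
          for only one of the two leaves besides \<open>x\<close>.\<close>
        obtain k2 where k2: "k2 \<in> K" "k2 \<inter> T1 \<inter> A = {}" using missed_nonempty[OF T1(1)] .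
        obtain u1 where u1: "k1 \<inter> A = {v, u1}" using leaf[OF k1(1)] by blast
        obtain u2 where u2: "k2 \<inter> A = {v, u2}" using leaf[OF k2(1)] by blast
        note miss1 = disjoint_trace_pair_iff[OF u1] and miss2 = disjoint_trace_pair_iff[OF u2]
        have "u1 \<in> T1" using T1(2) miss1 v_out[OF T1(1)] by blast
        moreover have "u1 \<notin> T0" "u2 \<notin> T1" using k1(2) k2(2) miss1 miss2 by blast+
        ultimately have ne: "x \<noteq> u1" "x \<noteq> u2" "u1 \<noteq> u2"
          using x[OF T0] x[OF T1(1)] by blast+
        show ?thesis
        proof (rule card_outside_le_4_of_two_missed[OF k1(1) k2(1) _ int int])
          fix T assume T: "T \<in> \<S> - K"
          have "card (T \<inter> A) = 2" using card_trace T by blast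
          then have "T \<inter> A = {x, u1}" if "u1 \<in> T \<inter> A"
            using card_2_eqI x[OF T] that ne(1) by metis
          then have "\<not> (u1 \<in> T \<inter> A \<and> u2 \<in> T \<inter> A)"
            using ne(2,3) by (metis insertE singletonD)
          moreover have "u1 \<in> A" "u2 \<in> A" using u1 u2 by auto
          ultimately show "k1 \<inter> T \<inter> A = {} \<or> k2 \<inter> T \<inter> A = {}"
            using v_out[OF T] miss1 miss2 by blast
        qed
      qed
    next
      case True
      show ?thesis unfolding True by simp
    qed
  qed
qed

lemma card_outside_maximal_le_4: "card (\<S> - K) \<le> 4"
proof -
  define F where "F = (\<lambda>k. k \<inter> A) ` K"
  have F1: "\<forall>e\<in>F. card e = 2" using card_trace K_sub by (auto simp: F_def)
  have F2: "\<forall>e\<in>F. \<forall>f\<in>F. e \<inter> f \<noteq> {}"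
    using K_int unfolding F_def intersecting_on_def by blast
  show ?thesis
  proof (cases rule: star_or_triangle[OF F1 F2, case_names star triangle])
    case (star v)
    then show ?thesis by (intro card_outside_le_4_star) (auto simp: F_def)
  next
    case (triangle x y z)
    then show ?thesis by (intro card_outside_le_4_triangle) (auto simp: F_def)
  qed
qed

end

section \<open>The bound\<close>

lemma card_le_of_seven_intersecting:
  assumes \<S>: "semiintersecting A B 2 \<S>" and fin: "finite \<S>" "finite B"
    and R: "R \<subseteq> \<S>" "card R = 7" "intersecting_on A R"
  shows "card \<S> \<le> card B div 2 + 4"
proof -
  define P where "P = {K. R \<subseteq> K \<and> K \<subseteq> \<S> \<and> intersecting_on A K}"
  have "finite P" "R \<in> P" using fin R by (auto simp: P_def)
  then obtain K where K: "K \<in> P" and max: "\<And>K'. K' \<in> P \<Longrightarrow> K \<subseteq> K' \<Longrightarrow> K' = K"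
    using finite_has_maximal2[of P R] by metis
  have KS: "K \<subseteq> \<S>" "R \<subseteq> K" "intersecting_on A K" using K by (auto simp: P_def)
  have finK: "finite K" using KS(1) fin(1) finite_subset by blast
  interpret maximal_intersecting A B \<S> K
  proof
    show "card K \<ge> 7" using card_mono[OF finK KS(2)] R(2) by simp
    show "\<not> intersecting_on A (insert T K)" if "T \<in> \<S> - K" for T
      using max[of "insert T K"] that KS by (auto simp: P_def)
  qed (use \<S> KS in auto)
  have "card \<S> = card K + card (\<S> - K)"
    using card_Diff_subset[OF finK KS(1)] card_mono[OF fin(1) KS(1)] by simp
  moreover have "2 * card K \<le> card B"
    by (rule card_intersecting_on_le[OF \<S> fin(2) KS(1) finK KS(3)])
  ultimately show ?thesis using card_outside_maximal_le_4 by linarith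
qed

lemma semiintersecting_2_card_le:
  assumes \<S>: "semiintersecting A B 2 \<S>"
    and AB: "finite A" "finite B" "card A = N" "card B = N"
    and N: "N div 2 \<ge> ramsey_number 7 7"
  shows "card \<S> \<le> N div 2 + 4"
proof (cases "card \<S> \<ge> ramsey_number 7 7")
  case True
  have "\<S> \<subseteq> Pow (A \<union> B)" using \<S> by (simp add: semiintersecting_def)
  then have fin: "finite \<S>" using AB finite_subset by blast
  obtain V where V: "V \<subseteq> \<S>" "card V = ramsey_number 7 7" "finite V"
    using True obtain_subset_with_card_n by metis
  have tr: "S \<inter> A \<noteq> {}" "S \<inter> B \<noteq> {}" if "S \<in> \<S>" for S
    using \<S> that unfolding semiintersecting_def by force+
  define E where "E = {{S, T} | S T. S \<in> V \<and> T \<in> V \<and> S \<noteq> T \<and> S \<inter> T \<inter> A \<noteq> {}}"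
  have "E \<subseteq> [V]\<^bsup>2\<^esup>" by (auto simp: E_def nsets_def card_insert_if)
  then obtain R where R: "R \<subseteq> V" "card R = 7 \<and> clique R E \<or> card R = 7 \<and> indep R E"
    using ramsey_number_works[OF V(3) V(2)] by blast
  have E_iff: "{S, T} \<in> E \<longleftrightarrow> S \<inter> T \<inter> A \<noteq> {}" if "S \<in> R" "T \<in> R" "S \<noteq> T" for S T
    using that R(1) unfolding E_def by (auto simp: doubleton_eq_iff)
  have RS: "R \<subseteq> \<S>" using R(1) V(1) by blast
  show ?thesis
  proof (cases "clique R E")
    case True
    then have "S \<inter> T \<inter> A \<noteq> {}" if "S \<in> R" "T \<in> R" for S T
      using that E_iff tr RS unfolding clique_def by (cases "S = T") auto
    then have "intersecting_on A R" by (auto simp: intersecting_on_def)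
    then show ?thesis
      using card_le_of_seven_intersecting[OF \<S> fin AB(2) RS] R(2) AB by auto
  next
    case False
    then have "indep R E" using R(2) by blast
    then have "S \<inter> T \<inter> B \<noteq> {}" if "S \<in> R" "T \<in> R" for S T
      using that E_iff[of S T] tr[of S] RS semiintersecting_meet_iff[OF \<S>, of S T]
      unfolding indep_def by (cases "S = T") auto
    then have "intersecting_on B R" by (auto simp: intersecting_on_def)
    moreover have "semiintersecting B A 2 \<S>" using \<S> semiintersecting_commute by blast
    ultimately show ?thesis
      using card_le_of_seven_intersecting[of B A \<S> R] fin RS R(2) AB by auto
  qed
qed (use N in simp)

theorem theorem2p3:
  fixes N :: nat
  assumes "N > 0"
    and "N div 2 \<ge> ramsey_number 7 7"
  shows "max_semiintersecting 2 N \<le> N div 2 + 4"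
proof -
  let ?A = "{0..<N}" and ?B = "{N..<2 * N}"
  have AB: "finite ?A" "finite ?B" "card ?A = N" "card ?B = N" "?A \<inter> ?B = {}" by auto
  note max_eq = max_semiintersecting_eq[OF AB, of 2]
  show ?thesis
    unfolding max_eq(1)
    by (rule Max.boundedI[OF max_eq(2) max_eq(3)])
       (use semiintersecting_2_card_le[OF _ AB(1-4) assms(2)] in blast)
qed

end
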